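(* Let $n=p^\alpha$ be a power of a prime $p$, let $q=p^\omega$ with $\omega\mid\alpha$, let $H=\mathrm{Gal}(GF(n)/GF(q))$, and let $X$ be the AST obtained from the action of $ASL_H(2,n)$ on the $2$-dimensional vector space $V=GF(n)^2$ over $GF(n)$. Then $X$ has $$-3+2\left(\frac{\omega}{\alpha}\sum_{\beta=1}^{\alpha/\omega}q^{\gcd(\alpha/\omega,\,\beta)}\right)$$ nontrivial relations. There are $$-2+\frac{\omega}{\alpha}\sum_{\beta=1}^{\alpha/\omega}q^{\gcd(\alpha/\omega,\,\beta)}$$ nontrivial relations of the form $R^a=[(\vec 0,\vec 1,\vec a)]$ with $a\in GF(n)$, $a\neq 0,1$; the relation $R^a$ has third valency $\deg_{GF(q)}(a)$. The remaining $$-1+\frac{\omega}{\alpha}\sum_{\beta=1}^{\alpha/\omega}q^{\gcd(\alpha/\omega,\,\beta)}$$ nontrivial relations of $X$ are of the form ${}^{\mathfrak a}R=[(\vec 0,\vec 1,(0,\mathfrak a)^T)]$ with $\mathfrak a\in GF(n)$, $\mathfrak a\neq 0$; the relation ${}^{\mathfrak a}R$ has third valency $n\deg_{GF(q)}(\mathfrak a)$.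
   Context: Association scheme on triples (AST). Let $\Omega$ be a finite set with at least 3 elements. An AST on $\Omega$ is a partition $X=\{R_i\}_{i=0}^m$ of $\Omega\times\Omega\times\Omega$, $m\ge 4$, such that: (1) for each $i$ there is an integer $n_i^{(3)}$ such that for every pair of distinct $x,y\in\Omega$ the number of $z\in\Omega$ with $(x,y,z)\in R_i$ is $n_i^{(3)}$ (called the third valency of $R_i$); (2) for all $i,j,k,l$ there is a constant $p_{ijk}^l$ (an intersection number) such that for every $(x,y,z)\in R_l$ the number of $w$ with $(w,y,z)\in R_i$, $(x,w,z)\in R_j$, $(x,y,w)\in R_k$ is $p_{ijk}^l$; (3) for every $i$ and every $\sigma\in S_3$ there is $j$ with $R_j=\{(x_{\sigma(1)},x_{\sigma(2)},x_{\sigma(3)}):(x_1,x_2,x_3)\in R_i\}$; (4) $R_0=\{(x,x,x):x\in\Omega\}$, $R_1=\{(x,y,y):x\ne y\}$, $R_2=\{(y,x,y):x\neq y\}$, $R_3=\{(y,y,x):x\ne y\}$. The relations $R_0,R_1,R_2,R_3$ are called trivial and all others nontrivial. If a group $G$ acts two-transitively on $\Omega$, the set of orbits of the induced diagonal action of $G$ on $\Omega\times\Omega\times\Omega$ is an AST, called the AST obtained from (the action of) $G$. $GF(n)$ is the field with $n$ elements. For $k\geq 2$, $V=GF(n)^k$ and a subgroup $H$ of the automorphism group $\mathrm{Gal}(GF(n))$ of $GF(n)$ (acting on $V$ coordinatewise), $ASL_H(k,n)=ASL(k,n)\rtimes H$ is the group of maps $V\to V$ of the form $x\mapsto A\phi(x)+b$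 with $A\in SL(k,n)$, $b\in V$, $\phi\in H$. For $a\in GF(n)$, $\vec a=(a,0,\ldots,0)^T\in V$. For $(u,v,w)\in V\times V\times V$, $[(u,v,w)]$ denotes its orbit under $ASL_H(k,n)$ (here $k=2$). $\deg_{GF(q)}(a)$ is the degree of the minimal polynomial of $a$ over $GF(q)$. The relations $R^a$ (respectively ${}^{\mathfrak a}R$) for different parameters may coincide; the counts are of distinct relations. *)

theory Defs
  imports "HOL-Analysis.Analysis" "HOL-Library.Disjoint_Sets"
    "HOL-Combinatorics.Permutations" "HOL-Computational_Algebra.Computational_Algebra"
begin

definition triv0 :: "'v set \<Rightarrow> ('v \<times> 'v \<times> 'v) set" where
  "triv0 \<Omega> = {(x, x, x) | x. x \<in> \<Omega>}"

definition triv1 :: "'v set \<Rightarrow> ('v \<times> 'v \<times> 'v) set" where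
  "triv1 \<Omega> = {(x, y, y) | x y. x \<in> \<Omega> \<and> y \<in> \<Omega> \<and> x \<noteq> y}"

definition triv2 :: "'v set \<Rightarrow> ('v \<times> 'v \<times> 'v) set" where
  "triv2 \<Omega> = {(y, x, y) | x y. x \<in> \<Omega> \<and> y \<in> \<Omega> \<and> x \<noteq> y}"

definition triv3 :: "'v set \<Rightarrow> ('v \<times> 'v \<times> 'v) set" where
  "triv3 \<Omega> = {(y, y, x) | x y. x \<in> \<Omega> \<and> y \<in> \<Omega> \<and> x \<noteq> y}"

definition has_third_valency :: "'v set \<Rightarrow> ('v \<times> 'v \<times> 'v) set \<Rightarrow> nat \<Rightarrow> bool" where
  "has_third_valency \<Omega> R v \<longleftrightarrow>
     (\<forall>x\<in>\<Omega>. \<forall>y\<in>\<Omega>. x \<noteq> y \<longrightarrow> card {z \<in> \<Omega>. (x, y, z) \<in> R} = v)"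

fun triple_entry :: "'v \<times> 'v \<times> 'v \<Rightarrow> nat \<Rightarrow> 'v" where
  "triple_entry (x1, x2, x3) i = (if i = 1 then x1 else if i = 2 then x2 else x3)"

definition permute_triple :: "(nat \<Rightarrow> nat) \<Rightarrow> 'v \<times> 'v \<times> 'v \<Rightarrow> 'v \<times> 'v \<times> 'v" where
  "permute_triple \<sigma> t = (triple_entry t (\<sigma> 1), triple_entry t (\<sigma> 2), triple_entry t (\<sigma> 3))"

text \<open>
  The scheme is the unindexed set \<open>X\<close> of its relations \<open>R\<^sub>0, \<dots>, R\<^sub>m\<close>,
  so \<open>m \<ge> 4\<close> reads \<open>card X \<ge> 5\<close>.
\<close>

definition AST :: "'v set \<Rightarrow> ('v \<times> 'v \<times> 'v) set set \<Rightarrow> bool" where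
  "AST \<Omega> X \<longleftrightarrow>
     finite \<Omega> \<and> card \<Omega> \<ge> 3 \<and>
     partition_on (\<Omega> \<times> \<Omega> \<times> \<Omega>) X \<and> card X \<ge> 5 \<and>
     (\<forall>R\<in>X. \<exists>v. has_third_valency \<Omega> R v) \<and>
     (\<forall>Ri\<in>X. \<forall>Rj\<in>X. \<forall>Rk\<in>X. \<forall>Rl\<in>X. \<exists>c. \<forall>x y z. (x, y, z) \<in> Rl \<longrightarrow>
        card {w \<in> \<Omega>. (w, y, z) \<in> Ri \<and> (x, w, z) \<in> Rj \<and> (x, y, w) \<in> Rk} = c) \<and>
     (\<forall>R\<in>X. \<forall>\<sigma>. \<sigma> permutes {1, 2, 3} \<longrightarrow> permute_triple \<sigma> ` R \<in> X) \<and>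
     triv0 \<Omega> \<in> X \<and> triv1 \<Omega> \<in> X \<and> triv2 \<Omega> \<in> X \<and> triv3 \<Omega> \<in> X"

definition nontrivial_relations :: "'v set \<Rightarrow> ('v \<times> 'v \<times> 'v) set set \<Rightarrow> ('v \<times> 'v \<times> 'v) set set" where
  "nontrivial_relations \<Omega> X = X - {triv0 \<Omega>, triv1 \<Omega>, triv2 \<Omega>, triv3 \<Omega>}"

definition triple_orbit :: "('v \<Rightarrow> 'v) set \<Rightarrow> 'v \<times> 'v \<times> 'v \<Rightarrow> ('v \<times> 'v \<times> 'v) set" where
  "triple_orbit G = (\<lambda>(u, v, w). {(g u, g v, g w) | g. g \<in> G})"

definition AST_of_action :: "('v \<Rightarrow> 'v) set \<Rightarrow> 'v set \<Rightarrow> ('v \<times> 'v \<times> 'v) set set" where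
  "AST_of_action G \<Omega> = triple_orbit G ` (\<Omega> \<times> \<Omega> \<times> \<Omega>)"

definition is_subfield :: "'a::field set \<Rightarrow> bool" where
  "is_subfield K \<longleftrightarrow> 0 \<in> K \<and> 1 \<in> K \<and>
     (\<forall>x\<in>K. \<forall>y\<in>K. x + y \<in> K \<and> x * y \<in> K) \<and> (\<forall>x\<in>K. - x \<in> K \<and> inverse x \<in> K)"

definition field_automorphism :: "('a::field \<Rightarrow> 'a) \<Rightarrow> bool" where
  "field_automorphism \<phi> \<longleftrightarrow> bij \<phi> \<and> \<phi> 1 = 1 \<and>
     (\<forall>x y. \<phi> (x + y) = \<phi> x + \<phi> y) \<and> (\<forall>x y. \<phi> (x * y) = \<phi> x * \<phi> y)"

definition Gal :: "'a::field set \<Rightarrow> ('a \<Rightarrow> 'a) set" where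
  "Gal K = {\<phi>. field_automorphism \<phi> \<and> (\<forall>x\<in>K. \<phi> x = x)}"

definition is_min_poly :: "'a::field set \<Rightarrow> 'a \<Rightarrow> 'a poly \<Rightarrow> bool" where
  "is_min_poly K a f \<longleftrightarrow>
     lead_coeff f = 1 \<and> (\<forall>i. coeff f i \<in> K) \<and> poly f a = 0 \<and>
     (\<forall>g. g \<noteq> 0 \<and> (\<forall>i. coeff g i \<in> K) \<and> poly g a = 0 \<longrightarrow> degree f \<le> degree g)"

definition min_poly :: "'a::field set \<Rightarrow> 'a \<Rightarrow> 'a poly" where
  "min_poly K a = (THE f. is_min_poly K a f)"

definition deg_over :: "'a::field set \<Rightarrow> 'a \<Rightarrow> nat" where
  "deg_over K a = degree (min_poly K a)"

definition ASL :: "('a::field \<Rightarrow> 'a) set \<Rightarrow> ('a ^ 'k \<Rightarrow> 'a ^ 'k) set" where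
  "ASL H = {\<lambda>x. A *v (\<chi> i. \<phi> (x $ i)) + b | A b \<phi>. det A = 1 \<and> \<phi> \<in> H}"

definition rel_first :: "('a::field ^ 2 \<Rightarrow> 'a ^ 2) set \<Rightarrow> 'a \<Rightarrow> (('a ^ 2) \<times> ('a ^ 2) \<times> ('a ^ 2)) set" where
  "rel_first G a = triple_orbit G (vector [0, 0], vector [1, 0], vector [a, 0])"

definition rel_second :: "('a::field ^ 2 \<Rightarrow> 'a ^ 2) set \<Rightarrow> 'a \<Rightarrow> (('a ^ 2) \<times> ('a ^ 2) \<times> ('a ^ 2)) set" where
  "rel_second G a = triple_orbit G (vector [0, 0], vector [1, 0], vector [0, a])"

end

theory Submission
  imports Defs "HOL-Combinatorics.Orbits"
begin

text \<open>
  The group \<open>G = ASL\<^sub>H(2, n)\<close> is two-transitive on \<open>V\<close>, so every nontrivial relation is the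
  \<open>G\<close>-orbit of some \<open>(0, e\<^sub>1, w)\<close> with \<open>w \<noteq> 0, e\<^sub>1\<close>. The stabiliser of \<open>(0, e\<^sub>1)\<close> consists of the
  maps \<open>(w\<^sub>1, w\<^sub>2) \<mapsto> (\<phi> w\<^sub>1 + b \<phi> w\<^sub>2, \<phi> w\<^sub>2)\<close> with \<open>\<phi> \<in> H\<close>: its orbits are \<open>Ha \<times> {0}\<close> and, for
  \<open>a \<noteq> 0\<close>, \<open>GF(n) \<times> Ha\<close>, where \<open>Ha\<close> denotes the \<open>H\<close>-orbit of \<open>a\<close>. The counts thus reduce to the
  number of \<open>H\<close>-orbits on \<open>GF(n)\<close> and the valencies to their sizes.

  The Frobenius orbit of \<open>a\<close> under \<open>x \<mapsto> x\<^sup>q\<close> is the root set of the minimal polynomial of \<open>a\<close>,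
  hence equals \<open>Ha\<close> (without knowing that \<open>H\<close> is cyclic) and has \<open>deg a\<close> elements. Burnside's
  lemma for the cyclic group generated by the Frobenius map counts the orbits, since \<open>x\<^bsup>q^\<beta>\<^esup> = x\<close>
  has \<open>q\<^bsup>gcd(m, \<beta>)\<^esup>\<close> solutions in \<open>GF(q\<^sup>m)\<close>.
\<close>

section \<open>Schemes of two-transitive permutation groups\<close>

lemma triple_orbit_iff:
  "(x, y, z) \<in> triple_orbit G (u, v, w) \<longleftrightarrow> (\<exists>g\<in>G. x = g u \<and> y = g v \<and> z = g w)"
  by (auto simp: triple_orbit_def)

text \<open>A group element acts by the same map on all three entries, so its action commutes with
  rearranging them. This gives the symmetry axiom of a scheme.\<close>

lemma permute_triple_triple_orbit:
  fixes G :: "('v \<Rightarrow> 'v) set"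
  shows "permute_triple \<sigma> ` triple_orbit G t = triple_orbit G (permute_triple \<sigma> t)"
proof -
  obtain u v w where t: "t = (u, v, w)"
    by (metis prod_cases3)
  have image: "triple_orbit G (x, y, z) = (\<lambda>g. (g x, g y, g z)) ` G" for x y z
    by (auto simp: triple_orbit_def)
  have "permute_triple \<sigma> (g u, g v, g w) =
      (g (triple_entry t (\<sigma> 1)), g (triple_entry t (\<sigma> 2)), g (triple_entry t (\<sigma> 3)))" for g :: "'v \<Rightarrow> 'v"
    by (simp add: permute_triple_def t)
  then show ?thesis
    by (simp only: permute_triple_def[of \<sigma> "(u, v, w)"] image image_image t)
qed

lemma card_Collect_bij:
  assumes "bij g"
  shows "card {z. P z} = card {z. P (g z)}"
proof -
  have "{z. P z} = g ` {z. P (g z)}"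
    using bij_is_surj[OF assms] by (force simp: surj_def image_iff)
  then show ?thesis
    using bij_is_inj[OF assms] by (simp add: card_image inj_on_subset)
qed

text \<open>The size of an image depends only on which arguments are identified. This turns counting
  relations into counting \<open>H\<close>-orbits of parameters.\<close>

lemma card_image_cong_eq:
  assumes "\<And>x y. x \<in> A \<Longrightarrow> y \<in> A \<Longrightarrow> f x = f y \<longleftrightarrow> g x = g y"
  shows "card (f ` A) = card (g ` A)"
proof (rule bij_betw_same_card)
  \<comment> \<open>A value of \<open>f\<close> is sent to the value of \<open>g\<close> at a chosen
    preimage; by assumption the choice does not matter.\<close>
  let ?h = "\<lambda>u. g (inv_into A f u)"
  have h: "?h (f x) = g x" if "x \<in> A" for x
    using that assms[of "inv_into A f (f x)" x] by (simp add: inv_into_into f_inv_into_f)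
  have "inj_on ?h (f ` A)"
    using assms by (intro inj_onI) (clarsimp simp: h)
  moreover have "?h ` (f ` A) = g ` A"
    unfolding image_image using h by (rule image_cong[OF refl])
  ultimately show "bij_betw ?h (f ` A) (g ` A)"
    by (simp add: bij_betw_def)
qed

text \<open>A permutation group is kept as a bare set of functions. The locale serves both the group
  acting on the plane and the group of field automorphisms.\<close>

locale transformation_group =
  fixes G :: "('v \<Rightarrow> 'v) set"
  assumes id_mem: "id \<in> G"
    and comp_mem: "g \<in> G \<Longrightarrow> h \<in> G \<Longrightarrow> g \<circ> h \<in> G"
    and bij_mem: "g \<in> G \<Longrightarrow> bij g"
    and inv_mem: "g \<in> G \<Longrightarrow> inv g \<in> G"
begin

lemma triple_orbit_self: "t \<in> triple_orbit G t"
  using id_mem by (cases t) (auto simp: triple_orbit_iff intro!: bexI[of _ id])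

lemma triple_orbit_apply_iff:
  assumes "g \<in> G"
  shows "(g x, g y, g z) \<in> triple_orbit G t \<longleftrightarrow> (x, y, z) \<in> triple_orbit G t"
proof (cases t)
  case (fields u v w)
  show ?thesis
  proof
    assume "(g x, g y, g z) \<in> triple_orbit G t"
    then obtain h where h: "h \<in> G" "g x = h u" "g y = h v" "g z = h w"
      by (auto simp: fields triple_orbit_iff)
    have "inv g (g s) = s" for s
      using bij_mem[OF assms] by (simp add: bij_is_inj)
    then have "x = (inv g \<circ> h) u" "y = (inv g \<circ> h) v" "z = (inv g \<circ> h) w"
      using h(2-4) by (metis comp_apply)+
    then show "(x, y, z) \<in> triple_orbit G t"
      using comp_mem[OF inv_mem[OF assms] h(1)] unfolding fields triple_orbit_iff by blast
  next
    assume "(x, y, z) \<in> triple_orbit G t"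
    then obtain h where h: "h \<in> G" "x = h u" "y = h v" "z = h w"
      by (auto simp: fields triple_orbit_iff)
    then show "(g x, g y, g z) \<in> triple_orbit G t"
      using comp_mem[OF assms h(1)] by (auto simp: fields triple_orbit_iff intro!: bexI[of _ "g \<circ> h"])
  qed
qed

text \<open>Right multiplication by \<open>g\<close> is a bijection of the group, so moving the
  representative by \<open>g\<close> only reparametrises the orbit.\<close>

lemma triple_orbit_apply:
  assumes "g \<in> G"
  shows "triple_orbit G (g x, g y, g z) = triple_orbit G (x, y, z)"
proof -
  have "s \<in> triple_orbit G (g x, g y, g z) \<longleftrightarrow> s \<in> triple_orbit G (x, y, z)" for s
  proof (cases s)
    case (fields a b c)
    have "s \<in> triple_orbit G (x, y, z)" if "h \<in> G" "s = (h (g x), h (g y), h (g z))" for h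
      using comp_mem[OF that(1) assms] that(2)
      by (auto simp: triple_orbit_iff intro!: bexI[of _ "h \<circ> g"])
    moreover have "s \<in> triple_orbit G (g x, g y, g z)" if "h \<in> G" "s = (h x, h y, h z)" for h
      using comp_mem[OF that(1) inv_mem[OF assms]] that(2) bij_mem[OF assms]
      by (auto simp: triple_orbit_iff bij_is_inj intro!: bexI[of _ "h \<circ> inv g"])
    ultimately show ?thesis
      by (auto simp: triple_orbit_iff fields)
  qed
  then show ?thesis
    by blast
qed

lemma triple_orbit_eq: "s \<in> triple_orbit G t \<Longrightarrow> triple_orbit G s = triple_orbit G t"
  by (cases s; cases t) (auto simp: triple_orbit_iff triple_orbit_apply)

lemma partition_on_AST_of_action:
  "partition_on (UNIV \<times> UNIV \<times> UNIV) (AST_of_action G UNIV)"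
proof (rule partition_onI)
  show "\<Union> (AST_of_action G UNIV) = UNIV \<times> UNIV \<times> UNIV"
    using triple_orbit_self by (fastforce simp: AST_of_action_def)
next
  fix R S assume "R \<in> AST_of_action G UNIV" "S \<in> AST_of_action G UNIV" "R \<noteq> S"
  then show "disjnt R S"
    by (auto simp: AST_of_action_def disjnt_iff) (metis triple_orbit_eq)+
next
  show "{} \<notin> AST_of_action G UNIV"
    using triple_orbit_self by (force simp: AST_of_action_def)
qed

lemma card_third_place_apply:
  assumes "g \<in> G"
  shows "card {z. (g x, g y, z) \<in> triple_orbit G t} = card {z. (x, y, z) \<in> triple_orbit G t}"
proof -
  have "card {z. (g x, g y, z) \<in> triple_orbit G t} = card {z. (g x, g y, g z) \<in> triple_orbit G t}"
    by (rule card_Collect_bij) (rule bij_mem[OF assms])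
  then show ?thesis
    by (simp add: triple_orbit_apply_iff[OF assms])
qed

text \<open>Substituting \<open>g w\<close> for the counted point \<open>w\<close> puts
  \<open>g\<close> in front of every entry, where invariance of the three orbits cancels it. As each
  relation is a single orbit, the count is constant on it.\<close>

lemma intersection_number_apply:
  assumes g: "g \<in> G"
  shows "card {w. (w, g y, g z) \<in> triple_orbit G r \<and> (g x, w, g z) \<in> triple_orbit G s \<and>
        (g x, g y, w) \<in> triple_orbit G t} =
    card {w. (w, y, z) \<in> triple_orbit G r \<and> (x, w, z) \<in> triple_orbit G s \<and>
        (x, y, w) \<in> triple_orbit G t}" (is "card ?A = card ?B")
proof -
  have "card ?A = card {w. (g w, g y, g z) \<in> triple_orbit G r \<and>
      (g x, g w, g z) \<in> triple_orbit G s \<and> (g x, g y, g w) \<in> triple_orbit G t}"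
    by (rule card_Collect_bij) (rule bij_mem[OF g])
  then show ?thesis
    by (simp only: triple_orbit_apply_iff[OF g])
qed

end

section \<open>Relations and scheme axioms for a two-transitive group\<close>

locale two_transitive_group = transformation_group G for G :: "('v :: finite \<Rightarrow> 'v) set" +
  fixes o\<^sub>1 o\<^sub>2 :: 'v
  assumes base_points: "o\<^sub>1 \<noteq> o\<^sub>2"
    and two_transitive: "x \<noteq> y \<Longrightarrow> \<exists>g\<in>G. g o\<^sub>1 = x \<and> g o\<^sub>2 = y"
begin

text \<open>Every pair of distinct points is an image of the base pair, and the count is invariant
  under the group, so it can be evaluated at the base pair.\<close>

lemma has_third_valency_triple_orbit:
  "has_third_valency UNIV (triple_orbit G t) (card {z. (o\<^sub>1, o\<^sub>2, z) \<in> triple_orbit G t})"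
  using card_third_place_apply[of _ "o\<^sub>1" "o\<^sub>2" t] two_transitive
  by (fastforce simp: has_third_valency_def)

lemma apply_eq_iff: "g \<in> G \<Longrightarrow> g x = g y \<longleftrightarrow> x = y"
  using bij_mem by (simp add: bij_is_inj inj_eq)

text \<open>A triple with a prescribed coincidence of entries is determined by one point or by an
  ordered pair of distinct points, and the group is transitive on both.\<close>

lemma triple_orbit_triv:
  shows triple_orbit_triv0: "triple_orbit G (o\<^sub>1, o\<^sub>1, o\<^sub>1) = triv0 UNIV"
    and triple_orbit_triv1: "triple_orbit G (o\<^sub>1, o\<^sub>2, o\<^sub>2) = triv1 UNIV"
    and triple_orbit_triv2: "triple_orbit G (o\<^sub>1, o\<^sub>2, o\<^sub>1) = triv2 UNIV"
    and triple_orbit_triv3: "triple_orbit G (o\<^sub>1, o\<^sub>1, o\<^sub>2) = triv3 UNIV"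
proof -
  have "\<exists>g\<in>G. g o\<^sub>1 = x" for x
    using two_transitive base_points by metis
  then show "triple_orbit G (o\<^sub>1, o\<^sub>1, o\<^sub>1) = triv0 UNIV"
    by (auto simp: triv0_def triple_orbit_iff) metis
  show "triple_orbit G (o\<^sub>1, o\<^sub>2, o\<^sub>2) = triv1 UNIV" "triple_orbit G (o\<^sub>1, o\<^sub>2, o\<^sub>1) = triv2 UNIV"
    "triple_orbit G (o\<^sub>1, o\<^sub>1, o\<^sub>2) = triv3 UNIV"
    using two_transitive base_points
    by (auto simp: triv1_def triv2_def triv3_def triple_orbit_iff apply_eq_iff) metis+
qed

lemma triv_mem_AST_of_action:
  "{triv0 UNIV, triv1 UNIV, triv2 UNIV, triv3 UNIV} \<subseteq> AST_of_action G UNIV"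
  unfolding AST_of_action_def triple_orbit_triv[symmetric] by simp

text \<open>Two-transitivity moves the first two entries of a representative to the base pair,
  leaving only the third entry as a parameter.\<close>

lemma nontrivial_relations_AST_of_action:
  "nontrivial_relations UNIV (AST_of_action G UNIV) =
    (\<lambda>z. triple_orbit G (o\<^sub>1, o\<^sub>2, z)) ` (- {o\<^sub>1, o\<^sub>2})" (is "?N = ?I")
proof -
  \<comment> \<open>Being a trivial relation can be read off from any representative: the trivial
    relations exhaust the triples with a coincidence, and each of them is an orbit.\<close>
  have triv: "triple_orbit G (x, y, z) \<in> {triv0 UNIV, triv1 UNIV, triv2 UNIV, triv3 UNIV}
    \<longleftrightarrow> x = y \<or> y = z \<or> x = z" for x y z
  proof
    assume "triple_orbit G (x, y, z) \<in> {triv0 UNIV, triv1 UNIV, triv2 UNIV, triv3 UNIV}"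
    moreover have "(x, y, z) \<in> triple_orbit G (x, y, z)"
      by (rule triple_orbit_self)
    ultimately show "x = y \<or> y = z \<or> x = z"
      by (auto simp: triv0_def triv1_def triv2_def triv3_def)
  next
    assume "x = y \<or> y = z \<or> x = z"
    then have "(x, y, z) \<in> triv0 UNIV \<union> triv1 UNIV \<union> triv2 UNIV \<union> triv3 UNIV"
      by (auto simp: triv0_def triv1_def triv2_def triv3_def)
    then show "triple_orbit G (x, y, z) \<in> {triv0 UNIV, triv1 UNIV, triv2 UNIV, triv3 UNIV}"
      using triple_orbit_eq triple_orbit_triv by (metis Un_iff insertCI)
  qed
  show ?thesis
  proof
    show "?N \<subseteq> ?I"
    proof
      fix R assume R: "R \<in> ?N"
      then obtain x y z where xyz: "R = triple_orbit G (x, y, z)"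
        by (auto simp: nontrivial_relations_def AST_of_action_def)
      with R have ne: "x \<noteq> y" "y \<noteq> z" "x \<noteq> z"
        using triv[of x y z] by (auto simp: nontrivial_relations_def)
      then obtain g where g: "g \<in> G" "g o\<^sub>1 = x" "g o\<^sub>2 = y"
        using two_transitive by blast
      obtain z' where z': "z = g z'"
        using bij_mem[OF g(1)] by (metis bij_is_surj surjD)
      have "R = triple_orbit G (o\<^sub>1, o\<^sub>2, z')"
        using triple_orbit_apply[OF g(1), of o\<^sub>1 o\<^sub>2 z'] xyz g z' by simp
      moreover have "z' \<notin> {o\<^sub>1, o\<^sub>2}"
        using ne g z' by auto
      ultimately show "R \<in> ?I"
        by blast
    qed
    show "?I \<subseteq> ?N"
    proof
      fix R assume "R \<in> ?I"
      then obtain z where z: "z \<noteq> o\<^sub>1" "z \<noteq> o\<^sub>2" "R = triple_orbit G (o\<^sub>1, o\<^sub>2, z)"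
        by blast
      then show "R \<in> ?N"
        using triv[of o\<^sub>1 o\<^sub>2 z] base_points
        by (auto simp: nontrivial_relations_def AST_of_action_def simp del: UNIV_Times_UNIV)
    qed
  qed
qed

text \<open>The bound of five relations comes from the four trivial ones and a nontrivial one
  supplied by a third point. The valency and intersection axioms follow from invariance of the
  counts.\<close>

lemma AST_AST_of_action:
  assumes "CARD('v) \<ge> 3"
  shows "AST UNIV (AST_of_action G UNIV)"
proof -
  let ?X = "AST_of_action G UNIV" and ?T = "{triv0 UNIV :: ('v \<times> 'v \<times> 'v) set, triv1 UNIV, triv2 UNIV, triv3 UNIV}"
  have "card {o\<^sub>1, o\<^sub>2} < CARD('v)"
    using assms base_points by simp
  then have "{o\<^sub>1, o\<^sub>2} \<noteq> UNIV"
    by (metis less_irrefl)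
  then have "nontrivial_relations UNIV ?X \<noteq> {}"
    unfolding nontrivial_relations_AST_of_action by blast
  then obtain R where R: "R \<in> ?X" "R \<notin> ?T"
    by (auto simp: nontrivial_relations_def)
  \<comment> \<open>Each trivial relation contains a triple of base points that lies outside the
    trivial relations listed before it.\<close>
  have "(o\<^sub>1, o\<^sub>1, o\<^sub>1) \<in> triv0 UNIV" "(o\<^sub>1, o\<^sub>2, o\<^sub>2) \<in> triv1 UNIV"
    "(o\<^sub>1, o\<^sub>2, o\<^sub>1) \<in> triv2 UNIV" "(o\<^sub>1, o\<^sub>1, o\<^sub>2) \<in> triv3 UNIV"
    "(o\<^sub>1, o\<^sub>2, o\<^sub>2) \<notin> triv0 UNIV" "(o\<^sub>1, o\<^sub>2, o\<^sub>1) \<notin> triv0 UNIV" "(o\<^sub>1, o\<^sub>1, o\<^sub>2) \<notin> triv0 UNIV"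
    "(o\<^sub>1, o\<^sub>2, o\<^sub>1) \<notin> triv1 UNIV" "(o\<^sub>1, o\<^sub>1, o\<^sub>2) \<notin> triv1 UNIV" "(o\<^sub>1, o\<^sub>1, o\<^sub>2) \<notin> triv2 UNIV"
    using base_points by (auto simp: triv0_def triv1_def triv2_def triv3_def)
  then have distinct: "distinct [triv0 UNIV :: ('v \<times> 'v \<times> 'v) set, triv1 UNIV, triv2 UNIV, triv3 UNIV]"
    unfolding distinct.simps list.set by blast
  have "card ?T = 4"
    using distinct_card[OF distinct] by simp
  then have "card (insert R ?T) = 5"
    using R by (subst card_insert_disjoint) auto
  moreover have "finite ?X"
    by (simp add: AST_of_action_def)
  ultimately have "5 \<le> card ?X"
    using R triv_mem_AST_of_action by (metis card_mono insert_subset)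
  moreover have "\<exists>v. has_third_valency UNIV R v" if "R \<in> ?X" for R
    using that has_third_valency_triple_orbit by (auto simp: AST_of_action_def)
  moreover have "\<exists>c. \<forall>x y z. (x, y, z) \<in> Rl \<longrightarrow>
      card {w \<in> UNIV. (w, y, z) \<in> Ri \<and> (x, w, z) \<in> Rj \<and> (x, y, w) \<in> Rk} = c"
    if "Ri \<in> ?X" "Rj \<in> ?X" "Rk \<in> ?X" "Rl \<in> ?X" for Ri Rj Rk Rl
  proof -
    obtain a b c r s t where "Ri = triple_orbit G r" "Rj = triple_orbit G s"
      "Rk = triple_orbit G t" "Rl = triple_orbit G (a, b, c)"
      using \<open>Ri \<in> ?X\<close> \<open>Rj \<in> ?X\<close> \<open>Rk \<in> ?X\<close> \<open>Rl \<in> ?X\<close> unfolding AST_of_action_def by fast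
    then show ?thesis
      by (auto simp: triple_orbit_iff intersection_number_apply)
  qed
  moreover have "permute_triple \<sigma> ` R \<in> ?X" if "R \<in> ?X" for R \<sigma>
    using that by (auto simp: AST_of_action_def permute_triple_triple_orbit)
  ultimately show ?thesis
    unfolding AST_def using assms partition_on_AST_of_action triv_mem_AST_of_action
    by (intro conjI ballI allI impI) (simp_all del: UNIV_Times_UNIV)
qed

end

section \<open>Orbits of a periodic map and Galois groups of finite fields\<close>

lemma is_subfield_UNIV: "is_subfield UNIV"
  by (simp add: is_subfield_def)

text \<open>For \<open>x\<close> nonzero, multiplication by \<open>x\<close> permutes the nonzero
  elements of \<open>K\<close>. Comparing their product before and after gives a power of
  \<open>x\<close> equal to 1.\<close>

lemma finite_subfield_power_card:
  fixes K :: "'a::field set"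
  assumes K: "is_subfield K" and "finite K" "x \<in> K"
  shows "x ^ card K = x"
proof (cases "x = 0")
  case True
  have "card K > 0"
    using assms by (auto simp: card_gt_0_iff)
  with True show ?thesis
    by simp
next
  case False
  have "0 \<in> K"
    using K by (simp add: is_subfield_def)
  then have card: "card K = Suc (card (K - {0}))"
    by (rule card.remove[OF \<open>finite K\<close>])
  have closed: "x * y \<in> K" "y / x \<in> K" if "y \<in> K" for y
    using K \<open>x \<in> K\<close> that unfolding is_subfield_def divide_inverse by metis+
  have "(\<Prod>y\<in>K-{0}. y) = (\<Prod>y\<in>K-{0}. x * y)"
    by (rule prod.reindex_bij_witness[of _ "\<lambda>y. x * y" "\<lambda>y. y / x"])
      (use closed False in auto)
  also have "\<dots> = x ^ card (K - {0}) * (\<Prod>y\<in>K-{0}. y)"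
    by (simp add: prod.distrib)
  finally have "x ^ card (K - {0}) = 1"
    using \<open>finite K\<close> by simp
  then show ?thesis
    by (simp add: card)
qed

lemma finite_field_power_CARD:
  fixes x :: "'a::{field,finite}"
  shows "x ^ CARD('a) = x"
  by (rule finite_subfield_power_card[OF is_subfield_UNIV]) auto

text \<open>Translation by 1 permutes the ring, so adding 1 to every element leaves the sum of all
  elements unchanged.\<close>

lemma of_nat_CARD_eq_0: "of_nat CARD('a) = (0 :: 'a::{ring_1,finite})"
proof -
  have "(\<Sum>x\<in>UNIV. x + 1) = (\<Sum>x\<in>UNIV. x :: 'a)"
    by (rule sum.reindex_bij_witness[of _ "\<lambda>x. x - 1" "\<lambda>x. x + 1"]) auto
  then show ?thesis
    by (simp add: sum.distrib)
qed

lemma CHAR_eq_prime: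
  assumes "prime p" "CARD('a::{field,finite}) = p ^ k"
  shows "CHAR('a) = p"
proof -
  have "prime CHAR('a)"
    by (intro prime_CHAR_semidom finite_imp_CHAR_pos) auto
  moreover have "CHAR('a) dvd p ^ k"
    using of_nat_CARD_eq_0[where ?'a = 'a] assms(2) of_nat_eq_0_iff_char_dvd by metis
  ultimately show ?thesis
    using assms(1) by (metis prime_dvd_power primes_dvd_imp_eq)
qed

lemma card_power_eq_self_le:
  fixes r :: nat
  assumes "r \<ge> 2"
  shows "card {x :: 'a::idom. x ^ r = x} \<le> r"
proof -
  let ?P = "monom 1 r - monom 1 1 :: 'a poly"
  have "coeff ?P r = 1"
    using assms by simp
  then have "?P \<noteq> 0"
    by (metis coeff_0 zero_neq_one)
  moreover have "degree ?P \<le> r"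
    using assms by (intro degree_diff_le) (auto simp: degree_monom_eq)
  moreover have "{x. x ^ r = x} = {x. poly ?P x = 0}"
    by (auto simp: poly_monom)
  ultimately show ?thesis
    using card_poly_roots_bound[of ?P] by simp
qed

text \<open>The elements of \<open>K\<close> are already \<open>card K\<close> roots of X^(card K) -
  X, which cannot have more. Membership in \<open>K\<close> thus becomes an equation.\<close>

lemma finite_subfield_eq:
  fixes K :: "'a::field set"
  assumes "is_subfield K" "finite K" "card K \<ge> 2"
  shows "K = {x. x ^ card K = x}"
proof (rule card_subset_eq)
  let ?P = "monom 1 (card K) - monom 1 1 :: 'a poly"
  have "coeff ?P (card K) = 1"
    using assms by simp
  then have "?P \<noteq> 0"
    by (metis coeff_0 zero_neq_one)
  moreover have "{x. x ^ card K = x} = {x. poly ?P x = 0}"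
    by (auto simp: poly_monom)
  ultimately show fin: "finite {x :: 'a. x ^ card K = x}"
    using poly_roots_finite by metis
  show sub: "K \<subseteq> {x. x ^ card K = x}"
    using finite_subfield_power_card assms by auto
  show "card K = card {x :: 'a. x ^ card K = x}"
    using card_power_eq_self_le[where ?'a = 'a, OF assms(3)] card_mono[OF fin sub] by linarith
qed

text \<open>
  In a field with \<open>m + 1\<close> elements \<open>X\<^sup>m - 1\<close> splits into distinct linear factors,
  hence so does its divisor \<open>X\<^sup>k - 1\<close>.
\<close>

lemma card_roots_of_unity_finite_field:
  assumes m: "CARD('a::{field,finite}) = Suc m" and k: "k dvd m" "k > 0" "m > 0"
  shows "card {x :: 'a. x ^ k = 1} = k"
proof -
  obtain c where c: "m = k * c"
    using k by auto
  define P :: "'a poly" where "P = monom 1 k - 1"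
  define S :: "'a poly" where "S = (\<Sum>i<c. monom 1 (k * i))"
  have "coeff P k = 1"
    using k by (simp add: P_def)
  then have "P \<noteq> 0"
    by (metis coeff_0 zero_neq_one)
  have "degree P \<le> k"
    unfolding P_def by (intro degree_diff_le) (auto simp: degree_monom_eq)
  have "c > 0"
    using c k by (cases c) auto
  have "degree S \<le> k * (c - 1)"
    unfolding S_def using \<open>c > 0\<close>
    by (intro degree_sum_le) (auto intro!: order_trans[OF degree_monom_le] mult_left_mono)
  have "coeff S 0 = (\<Sum>i<c. if i = 0 then 1 else 0)"
    unfolding S_def coeff_sum using k by (intro sum.cong) auto
  then have "coeff S 0 = 1"
    using \<open>c > 0\<close> by simp
  then have "S \<noteq> 0"
    by auto
  have PS: "poly P x * poly S x = x ^ m - 1" for x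
    using power_diff_1_eq[of "x ^ k" c]
    by (simp add: P_def S_def poly_monom poly_sum c power_mult)
  have "x ^ m = 1" if "x \<noteq> 0" for x :: 'a
    using finite_field_power_CARD[of x] that m by simp
  then have "poly P x * poly S x = 0" if "x \<noteq> 0" for x
    using PS[of x] that by simp
  \<comment> \<open>Each of the m nonzero elements is a root of \<open>P\<close> or of the cofactor
    \<open>S\<close>. Since \<open>S\<close> has at most k(c - 1) = m - k roots, at least k remain
    for \<open>P\<close>.\<close>
  then have "- {0} \<subseteq> {x. poly P x = 0} \<union> {x. poly S x = 0}"
    by auto
  then have "card (- {0 :: 'a}) \<le> card ({x. poly P x = 0} \<union> {x. poly S x = 0})"
    by (intro card_mono) auto
  also have "\<dots> \<le> card {x. poly P x = 0} + card {x. poly S x = 0}"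
    by (rule card_Un_le)
  also have "card {x. poly S x = 0} \<le> k * (c - 1)"
    using card_poly_roots_bound[OF \<open>S \<noteq> 0\<close>] \<open>degree S \<le> _\<close> by linarith
  finally have "m \<le> card {x. poly P x = 0} + k * (c - 1)"
    by (simp add: Compl_eq_Diff_UNIV card_Diff_singleton m)
  moreover have "m = k + k * (c - 1)"
    using \<open>c > 0\<close> by (simp add: c flip: mult_Suc_right)
  moreover have "card {x. poly P x = 0} \<le> k"
    using card_poly_roots_bound[OF \<open>P \<noteq> 0\<close>] \<open>degree P \<le> k\<close> by linarith
  moreover have "{x. x ^ k = 1} = {x. poly P x = 0}"
    by (auto simp: P_def poly_monom)
  ultimately show ?thesis
    by simp
qed

lemma dvd_power_minus_1:
  fixes q :: nat
  assumes "d dvd m"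
  shows "q ^ d - 1 dvd q ^ m - 1"
proof -
  obtain c where m: "m = d * c"
    using assms by auto
  \<comment> \<open>The geometric sum is used over the integers, where subtraction is not
    truncated.\<close>
  have "int (q ^ d) - 1 dvd int (q ^ d) ^ c - 1"
    using power_diff_1_eq[of "int (q ^ d)" c] by simp
  then have "int (q ^ d) - 1 dvd int (q ^ m) - 1"
    by (simp add: m power_mult)
  then show ?thesis
    by (cases "q = 0"; cases "d = 0")
      (auto simp: power_0_left of_nat_diff m simp flip: int_dvd_int_iff)
qed

text \<open>The nonzero solutions are the roots of unity of exponent q^d - 1, a divisor of q^m - 1;
  the solution 0 adds one more.\<close>

lemma card_power_eq_self_finite_field:
  assumes "CARD('a::{field,finite}) = q ^ m" and "d dvd m" "d > 0" "m > 0" "q \<ge> 2"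
  shows "card {x :: 'a. x ^ (q ^ d) = x} = q ^ d"
proof -
  have "q ^ d > 1" "q ^ m > 1"
    using assms using one_less_power[of q d] one_less_power[of q m] by linarith+
  have "card {x :: 'a. x ^ (q ^ d - 1) = 1} = q ^ d - 1"
    by (rule card_roots_of_unity_finite_field[of "q ^ m - 1"])
      (use assms \<open>q ^ d > 1\<close> \<open>q ^ m > 1\<close> dvd_power_minus_1 in auto)
  moreover have "{x :: 'a. x ^ (q ^ d) = x} = insert 0 {x. x ^ (q ^ d - 1) = 1}"
  proof -
    have "x ^ (q ^ d) = x * x ^ (q ^ d - 1)" for x :: 'a
      using \<open>q ^ d > 1\<close> by (metis One_nat_def Suc_pred less_trans power_Suc zero_less_one)
    then show ?thesis
      by auto
  qed
  moreover have "(0 :: 'a) \<notin> {x. x ^ (q ^ d - 1) = 1}"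
    using \<open>q ^ d > 1\<close> by (simp add: power_0_left)
  ultimately show ?thesis
    using \<open>q ^ d > 1\<close> by simp
qed


section \<open>Burnside's lemma for a periodic map\<close>

lemma card_dvd_atLeastAtMost:
  fixes d m :: nat
  assumes "d > 0"
  shows "card {k \<in> {1..m}. d dvd k} = m div d"
proof -
  have "{k \<in> {1..m}. d dvd k} = (*) d ` {1..m div d}"
    using assms by (auto simp: less_eq_div_iff_mult_less_eq mult.commute elim!: dvdE)
  moreover have "inj_on ((*) d) {1..m div d}"
    using assms by (auto simp: inj_on_def)
  ultimately show ?thesis
    by (simp add: card_image)
qed

context
  fixes f :: "'a :: finite \<Rightarrow> 'a" and m :: nat
  assumes period: "f ^^ m = id" and pos: "m > 0"
begin

text \<open>\<open>orbit\<close> collects the iterates with at least one step; \<open>x\<close> is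
  among them as its own \<open>m\<close>-th iterate.\<close>

lemma self_mem_orbit_periodic: "x \<in> orbit f x"
  unfolding orbit_altdef using period pos by (metis (mono_tags) CollectI id_apply)

lemma orbit_eq_iff_periodic: "orbit f x = orbit f y \<longleftrightarrow> x \<in> orbit f y"
  using self_mem_orbit_periodic orbit_swap orbit_trans by (metis subsetI subset_antisym)

lemma orbit_altdef_periodic: "orbit f x = range (\<lambda>n. (f ^^ n) x)"
  using orbit_altdef_self_in[OF self_mem_orbit_periodic[of x]] by (simp add: full_SetCompr_eq)

text \<open>The length of the orbit is the least positive return time \<open>d\<close>, and
  \<open>n\<close> can be reduced modulo \<open>d\<close>.\<close>

lemma funpow_eq_self_iff_periodic: "(f ^^ n) x = x \<longleftrightarrow> card (orbit f x) dvd n"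
proof -
  define d where "d = funpow_dist1 f x x"
  have self: "x \<in> orbit f x"
    by (rule self_mem_orbit_periodic)
  have "d > 0" "(f ^^ d) x = x"
    using funpow_dist1_prop[OF self] by (simp_all add: d_def)
  have card: "card (orbit f x) = d"
    using inj_on_funpow_dist1[OF self] orbit_conv_funpow_dist1[OF self]
    by (simp add: d_def card_image)
  have "(f ^^ n) x = (f ^^ (n mod d)) x"
    using \<open>(f ^^ d) x = x\<close> by (simp add: funpow_mod_eq)
  moreover have "(f ^^ (n mod d)) x = x \<longleftrightarrow> n mod d = 0"
    using funpow_dist1_least[of "n mod d" f x x] \<open>d > 0\<close> by (auto simp: d_def[symmetric])
  ultimately show ?thesis
    by (simp add: card dvd_eq_mod_eq_0)
qed

text \<open>The orbit length always divides \<open>m\<close>, so it divides \<open>n\<close> exactly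
  when it divides the gcd.\<close>

lemma funpow_gcd_eq_self_iff_periodic: "(f ^^ gcd m n) x = x \<longleftrightarrow> (f ^^ n) x = x"
  using period by (simp add: funpow_eq_self_iff_periodic flip: funpow_eq_self_iff_periodic[of m x])

text \<open>Pairs of a point and an exponent between 1 and \<open>m\<close> fixing it are counted in
  two ways. A point in an orbit of length l has m/l such exponents, so each orbit contributes
  \<open>m\<close> in total.\<close>

lemma card_orbits_periodic:
  "m * card (range (orbit f)) = (\<Sum>n=1..m. card {x. (f ^^ n) x = x})"
proof -
  have dvd: "card (orbit f x) dvd m" for x
    using period by (simp flip: funpow_eq_self_iff_periodic)
  then have card_pos: "card (orbit f x) > 0" for x
    using pos by (metis dvd_pos_nat)
  have fibre: "{y. orbit f y = orbit f x} = orbit f x" for x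
    by (simp add: orbit_eq_iff_periodic)
  have "(\<Sum>n=1..m. card {x. (f ^^ n) x = x}) = (\<Sum>x\<in>UNIV. card {n \<in> {1..m}. (f ^^ n) x = x})"
    using sum_multicount_gen[of "{1..m}" "UNIV :: 'a set" "\<lambda>n x. (f ^^ n) x = x"] by simp
  also have "\<dots> = (\<Sum>x\<in>UNIV. m div card (orbit f x))"
    using card_dvd_atLeastAtMost[OF card_pos] by (simp only: funpow_eq_self_iff_periodic)
  also have "\<dots> = (\<Sum>S\<in>range (orbit f). \<Sum>x | orbit f x = S. m div card (orbit f x))"
    by (subst sum.image_gen[of _ _ "orbit f"]) simp_all
  also have "\<dots> = (\<Sum>S\<in>range (orbit f). m)"
  proof (intro sum.cong refl)
    fix S assume "S \<in> range (orbit f)"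
    then obtain x where S: "S = orbit f x"
      by blast
    have "(\<Sum>x | orbit f x = S. m div card (orbit f x)) = (\<Sum>x | orbit f x = S. m div card S)"
      by (intro sum.cong) auto
    also have "\<dots> = m"
      unfolding S fibre using dvd[of x] by simp
    finally show "(\<Sum>x | orbit f x = S. m div card (orbit f x)) = m" .
  qed
  finally show ?thesis
    by simp
qed

end

section \<open>Field automorphisms and minimal polynomials\<close>

lemma field_automorphismD:
  assumes "field_automorphism \<phi>"
  shows "bij \<phi>" "\<phi> 0 = 0" "\<phi> 1 = 1" "\<phi> (x + y) = \<phi> x + \<phi> y" "\<phi> (x * y) = \<phi> x * \<phi> y"
    "\<phi> (- x) = - \<phi> x" "\<phi> (x - y) = \<phi> x - \<phi> y" "\<phi> (x ^ n) = \<phi> x ^ n"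
    "\<phi> (sum g A) = (\<Sum>i\<in>A. \<phi> (g i))" "\<phi> x = \<phi> y \<longleftrightarrow> x = y"
proof -
  show "bij \<phi>" "\<phi> 1 = 1" "\<phi> (x * y) = \<phi> x * \<phi> y"
    using assms by (auto simp: field_automorphism_def)
  have "Modules.additive \<phi>"
    using assms by (simp add: Modules.additive_def field_automorphism_def)
  then show "\<phi> 0 = 0" "\<phi> (x + y) = \<phi> x + \<phi> y" "\<phi> (- x) = - \<phi> x" "\<phi> (x - y) = \<phi> x - \<phi> y"
    "\<phi> (sum g A) = (\<Sum>i\<in>A. \<phi> (g i))"
    by (simp_all add: Modules.additive.zero Modules.additive.add Modules.additive.minus
      Modules.additive.diff Modules.additive.sum)
  show "\<phi> (x ^ n) = \<phi> x ^ n"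
    using assms by (induction n) (simp_all add: field_automorphism_def)
  show "\<phi> x = \<phi> y \<longleftrightarrow> x = y"
    using \<open>bij \<phi>\<close> by (simp add: bij_is_inj inj_eq)
qed

lemma field_automorphism_eq_0_iff: "field_automorphism \<phi> \<Longrightarrow> \<phi> x = 0 \<longleftrightarrow> x = 0"
  using field_automorphismD(2,10) by metis

lemma field_automorphism_id: "field_automorphism id"
  by (simp add: field_automorphism_def)

lemma field_automorphism_comp:
  "field_automorphism \<phi> \<Longrightarrow> field_automorphism \<psi> \<Longrightarrow> field_automorphism (\<phi> \<circ> \<psi>)"
  by (simp add: field_automorphism_def bij_comp)

lemma field_automorphism_inv:
  assumes "field_automorphism \<phi>"
  shows "field_automorphism (inv \<phi>)"
proof -
  note \<phi> = field_automorphismD[OF assms]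
  have inv: "inv \<phi> x = y \<longleftrightarrow> x = \<phi> y" for x y
    by (metis \<phi>(1) bij_inv_eq_iff)
  have "\<phi> (inv \<phi> x) = x" for x
    using \<phi>(1) by (simp add: bij_is_surj surj_f_inv_f)
  then show ?thesis
    using \<phi>(1,3) by (simp add: field_automorphism_def inv \<phi>(4,5) bij_imp_bij_inv)
qed

lemma map_poly_field_automorphism_mult:
  assumes "field_automorphism \<phi>"
  shows "map_poly \<phi> (p * r) = map_poly \<phi> p * map_poly \<phi> r"
  by (rule poly_eqI) (simp add: coeff_map_poly coeff_mult field_automorphismD[OF assms])

lemma map_poly_field_automorphism_prod_linear:
  assumes "field_automorphism \<phi>"
  shows "map_poly \<phi> (\<Prod>b\<in>A. [:- b, 1:]) = (\<Prod>b\<in>A. [:- \<phi> b, 1:])"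
  by (induction A rule: infinite_finite_induct)
    (simp_all add: map_poly_field_automorphism_mult[OF assms] map_poly_pCons field_automorphismD[OF assms]
      del: mult_pCons_left)

lemma poly_Gal:
  assumes "\<phi> \<in> Gal K" "\<And>i. coeff g i \<in> K"
  shows "poly g (\<phi> x) = \<phi> (poly g x)"
proof -
  have \<phi>: "field_automorphism \<phi>" "\<And>i. \<phi> (coeff g i) = coeff g i"
    using assms by (auto simp: Gal_def)
  show ?thesis
    by (simp add: poly_altdef field_automorphismD[OF \<phi>(1)] \<phi>(2))
qed

text \<open>\<open>min_poly\<close> is a definite description, so uniqueness is required: the
  difference of two distinct minimal polynomials, both monic of the same degree, would vanish at
  \<open>a\<close> and have smaller degree.\<close>

lemma deg_over_eqI:
  assumes K: "is_subfield K" and f: "is_min_poly K a f"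
  shows "deg_over K a = degree f"
proof -
  have "g = f" if g: "is_min_poly K a g" for g
  proof (rule ccontr)
    assume "g \<noteq> f"
    have deg: "degree g = degree f"
    proof (rule antisym)
      have "f \<noteq> 0" "g \<noteq> 0"
        using f g by (auto simp: is_min_poly_def)
      with f g show "degree g \<le> degree f" "degree f \<le> degree g"
        by (auto simp: is_min_poly_def)
    qed
    have coeffs: "coeff (g - f) i \<in> K" for i
    proof -
      have "coeff g i \<in> K" "- coeff f i \<in> K"
        using f g K by (auto simp: is_min_poly_def is_subfield_def)
      then show ?thesis
        using K by (metis is_subfield_def coeff_diff diff_conv_add_uminus)
    qed
    have "coeff (g - f) i = 0" if "i \<ge> degree f" for i
      using that f g deg by (cases "i = degree f") (auto simp: is_min_poly_def coeff_eq_0)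
    then have "degree (g - f) < degree f"
      using \<open>g \<noteq> f\<close> by (intro degree_lessI) auto
    moreover have "degree f \<le> degree (g - f)"
      using f g coeffs \<open>g \<noteq> f\<close> unfolding is_min_poly_def by (metis eq_iff_diff_eq_0 poly_diff diff_self)
    ultimately show False
      by simp
  qed
  with f have "min_poly K a = f"
    unfolding min_poly_def by blast
  then show ?thesis
    by (simp add: deg_over_def)
qed

section \<open>Frobenius orbits, Galois orbits and degrees\<close>

locale finite_field_extension =
  fixes K :: "'a::{field,finite} set" and p q \<omega> m :: nat
  assumes prime: "prime p" and q_def: "q = p ^ \<omega>"
    and subfield: "is_subfield K" and card_K: "card K = q"
    and CARD_eq: "CARD('a) = q ^ m"
begin

lemma q_ge_2: "q \<ge> 2"
proof -
  have "card {0, 1 :: 'a} \<le> card K"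
    using subfield by (intro card_mono) (auto simp: is_subfield_def)
  then show ?thesis
    by (simp add: card_K)
qed

lemma m_pos: "m > 0"
proof (rule ccontr)
  assume "\<not> m > 0"
  then have "card {0, 1 :: 'a} \<le> 1"
    using card_mono[of UNIV "{0, 1 :: 'a}"] CARD_eq by simp
  then show False
    by simp
qed

abbreviation frob :: "'a \<Rightarrow> 'a" where "frob \<equiv> \<lambda>x. x ^ q"

lemma funpow_frob: "(frob ^^ i) x = x ^ (q ^ i)"
  by (induction i) (simp_all flip: power_mult add: mult.commute)

lemma funpow_frob_m: "frob ^^ m = id"
  using finite_field_power_CARD[where ?'a = 'a] by (simp add: fun_eq_iff funpow_frob CARD_eq)

lemma mem_K_iff: "x \<in> K \<longleftrightarrow> x ^ q = x"
  using finite_subfield_eq[OF subfield] q_ge_2 by (auto simp: card_K)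

text \<open>The map is additive because \<open>q\<close> is a power of the characteristic, injective
  because \<open>m - 1\<close> further iterations undo it, and fixes \<open>K\<close> because
  \<open>K\<close> is the solution set of x^q = x.\<close>

lemma frob_Gal: "frob \<in> Gal K"
proof -
  have "CHAR('a) = p"
    by (rule CHAR_eq_prime[OF prime, of "\<omega> * m"]) (simp add: CARD_eq q_def power_mult)
  then have "(x + y) ^ q = x ^ q + y ^ q" for x y :: 'a
    using prime by (intro freshmans_dream') (auto simp: q_def)
  moreover have "bij frob"
  proof -
    have "(frob ^^ (m - 1)) (frob x) = x" for x
      using fun_cong[OF funpow_frob_m, of x] m_pos by (cases m) (simp_all add: funpow_swap1 del: funpow.simps add: funpow_Suc_right)
    then have "inj frob"
      by (metis injI)
    then show ?thesis
      by (simp add: bij_def finite_UNIV_inj_surj)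
  qed
  ultimately show ?thesis
    by (simp add: Gal_def field_automorphism_def power_mult_distrib mem_K_iff)
qed

lemma funpow_frob_Gal: "frob ^^ i \<in> Gal K"
proof (induction i)
  case 0
  then show ?case
    using field_automorphism_id by (simp add: Gal_def id_def)
next
  case (Suc i)
  then show ?case
    using frob_Gal field_automorphism_comp[of frob "frob ^^ i"] by (simp add: Gal_def comp_def)
qed

text \<open>The product \<open>P\<close> of the X - b over the Frobenius orbit has
  Frobenius-invariant coefficients, so it lies over \<open>K\<close>. Galois automorphisms send its
  root \<open>a\<close> to roots of \<open>P\<close>, that is, into the orbit. A polynomial over
  \<open>K\<close> vanishing at \<open>a\<close> vanishes on the whole orbit, so \<open>P\<close> is
  minimal.\<close>

lemma
  shows Gal_orbit_eq: "(\<lambda>\<phi>. \<phi> a) ` Gal K = orbit frob a" (is "?orb")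
    and deg_over_eq: "deg_over K a = card (orbit frob a)"
proof -
  define P where "P = (\<Prod>b\<in>orbit frob a. [:- b, 1:])"
  have frob: "field_automorphism frob"
    using frob_Gal by (simp add: Gal_def)
  have inj: "inj_on frob (orbit frob a)"
    by (rule inj_on_subset[OF bij_is_inj[OF field_automorphismD(1)[OF frob]] subset_UNIV])
  then have "frob ` orbit frob a = orbit frob a"
    by (intro endo_inj_surj) (auto intro: orbit.step)
  then have "(\<Prod>b\<in>orbit frob a. [:- frob b, 1:]) = P"
    unfolding P_def using inj by (intro prod.reindex_bij_betw) (simp add: bij_betw_def)
  then have "map_poly frob P = P"
    unfolding P_def using map_poly_field_automorphism_prod_linear[OF frob] by simp
  then have "coeff (map_poly frob P) i = coeff P i" for i
    by simp
  \<comment> \<open>An invariant coefficient c satisfies c^q = c. The bound on \<open>q\<close>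
    gives 0^q = 0, which \<open>coeff_map_poly\<close> asks for.\<close>
  then have P_K: "coeff P i \<in> K" for i
    using q_ge_2 by (simp add: mem_K_iff coeff_map_poly)
  have P_root: "poly P b = 0 \<longleftrightarrow> b \<in> orbit frob a" for b
    by (auto simp: P_def poly_prod)
  have self: "a \<in> orbit frob a"
    by (rule self_mem_orbit_periodic[OF funpow_frob_m m_pos])
  have orbit: "orbit frob a = range (\<lambda>i. (frob ^^ i) a)"
    by (rule orbit_altdef_periodic[OF funpow_frob_m m_pos])
  show ?orb
  proof
    show "(\<lambda>\<phi>. \<phi> a) ` Gal K \<subseteq> orbit frob a"
    proof
      fix b assume "b \<in> (\<lambda>\<phi>. \<phi> a) ` Gal K"
      then obtain \<phi> where \<phi>: "\<phi> \<in> Gal K" "b = \<phi> a"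
        by blast
      then have "poly P b = \<phi> 0"
        using poly_Gal[OF \<phi>(1) P_K, of a] P_root[of a] self by simp
      then show "b \<in> orbit frob a"
        using \<phi>(1) by (simp add: P_root[symmetric] Gal_def field_automorphismD(2))
    qed
    show "orbit frob a \<subseteq> (\<lambda>\<phi>. \<phi> a) ` Gal K"
      unfolding orbit using funpow_frob_Gal by blast
  qed
  have "degree P = card (orbit frob a)"
    unfolding P_def by (subst degree_prod_eq_sum_degree) auto
  moreover have "is_min_poly K a P"
    unfolding is_min_poly_def
  proof (intro conjI allI impI)
    show "lead_coeff P = 1"
      unfolding P_def by (simp add: lead_coeff_prod)
    show "coeff P i \<in> K" for i
      by (rule P_K)
    show "poly P a = 0"
      using self by (simp add: P_root)
    fix g assume g: "g \<noteq> 0 \<and> (\<forall>i. coeff g i \<in> K) \<and> poly g a = 0"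
    have "poly g b = 0" if b: "b \<in> orbit frob a" for b
    proof -
      obtain i where "b = (frob ^^ i) a"
        using b unfolding orbit by blast
      then have "poly g b = (frob ^^ i) 0"
        using poly_Gal[OF funpow_frob_Gal, of g i a] g by simp
      also have "\<dots> = 0"
        using funpow_frob_Gal[of i] by (simp add: Gal_def field_automorphismD(2))
      finally show ?thesis .
    qed
    then have "card (orbit frob a) \<le> card {x. poly g x = 0}"
      by (intro card_mono) auto
    also have "\<dots> \<le> degree g"
      using g by (intro card_poly_roots_bound) auto
    finally show "degree P \<le> degree g"
      using \<open>degree P = _\<close> by simp
  qed
  ultimately show "deg_over K a = card (orbit frob a)"
    using deg_over_eqI[OF subfield] by simp
qed

text \<open>Galois orbits are Frobenius orbits, to which the Burnside count applies. The \<beta>-th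
  iterate has the same fixed points as the iterate with exponent \<open>gcd m \<beta>\<close>, a
  divisor of \<open>m\<close>.\<close>

lemma card_Gal_orbits:
  "m * card (range (\<lambda>a. (\<lambda>\<phi>. \<phi> a) ` Gal K)) = (\<Sum>\<beta>=1..m. q ^ gcd m \<beta>)"
proof -
  have "card {x. (frob ^^ \<beta>) x = x} = q ^ gcd m \<beta>" for \<beta>
  proof -
    have "{x. (frob ^^ \<beta>) x = x} = {x. x ^ (q ^ gcd m \<beta>) = x}"
      using funpow_gcd_eq_self_iff_periodic[OF funpow_frob_m m_pos, of \<beta>]
      by (simp add: funpow_frob)
    then show ?thesis
      using card_power_eq_self_finite_field[OF CARD_eq] m_pos q_ge_2 by simp
  qed
  then show ?thesis
    unfolding Gal_orbit_eq using card_orbits_periodic[OF funpow_frob_m m_pos] by simp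
qed

end

lemma transformation_group_Gal: "transformation_group (Gal K)"
proof
  show "id \<in> Gal K"
    by (simp add: Gal_def field_automorphism_id)
  show "\<phi> \<circ> \<psi> \<in> Gal K" if "\<phi> \<in> Gal K" "\<psi> \<in> Gal K" for \<phi> \<psi>
    using that by (auto simp: Gal_def intro: field_automorphism_comp)
  show "bij \<phi>" if "\<phi> \<in> Gal K" for \<phi>
    using that field_automorphismD(1) by (auto simp: Gal_def)
  show "inv \<phi> \<in> Gal K" if "\<phi> \<in> Gal K" for \<phi>
  proof -
    have "bij \<phi>" "\<forall>x\<in>K. \<phi> x = x"
      using that field_automorphismD(1) by (auto simp: Gal_def)
    then have "\<forall>x\<in>K. inv \<phi> x = x"
      by (metis bij_inv_eq_iff)
    then show ?thesis
      using that by (simp add: Gal_def field_automorphism_inv)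
  qed
qed

section \<open>The action on the plane\<close>

text \<open>The coordinate form of x -> A \<phi>(x) + v, where A has rows (a, b) and (c, d) and v =
  (e, f). It reduces the group laws to scalar identities.\<close>

definition semiaffine :: "'a::field \<Rightarrow> 'a \<Rightarrow> 'a \<Rightarrow> 'a \<Rightarrow> 'a \<Rightarrow> 'a \<Rightarrow> ('a \<Rightarrow> 'a) \<Rightarrow> 'a ^ 2 \<Rightarrow> 'a ^ 2" where
  "semiaffine a b c d e f \<phi> =
    (\<lambda>x. vector [a * \<phi> (x $ 1) + b * \<phi> (x $ 2) + e, c * \<phi> (x $ 1) + d * \<phi> (x $ 2) + f])"

lemma semiaffine_nth [simp]:
  "semiaffine a b c d e f \<phi> x $ 1 = a * \<phi> (x $ 1) + b * \<phi> (x $ 2) + e"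
  "semiaffine a b c d e f \<phi> x $ 2 = c * \<phi> (x $ 1) + d * \<phi> (x $ 2) + f"
  by (simp_all add: semiaffine_def)

lemma vec_eq_iff_2: "x = y \<longleftrightarrow> x $ 1 = y $ 1 \<and> x $ 2 = y $ 2" for x y :: "'a ^ 2"
  by (simp add: vec_eq_iff forall_2)

lemma ASL_2_eq:
  "ASL H = {semiaffine a b c d e f \<phi> | a b c d e f \<phi>. a * d - b * c = 1 \<and> \<phi> \<in> H}" (is "?L = ?R")
proof
  have "(\<lambda>x. A *v (\<chi> i. \<phi> (x $ i)) + v) =
      semiaffine (A $ 1 $ 1) (A $ 1 $ 2) (A $ 2 $ 1) (A $ 2 $ 2) (v $ 1) (v $ 2) \<phi>"
    for A :: "'a ^ 2 ^ 2" and v and \<phi> :: "'a \<Rightarrow> 'a"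
    by (rule ext) (simp add: vec_eq_iff_2 matrix_vector_mult_def sum_2)
  then show "?L \<subseteq> ?R"
    unfolding ASL_def det_2 by blast
  show "?R \<subseteq> ?L"
  proof
    fix g assume "g \<in> ?R"
    then obtain a b c d e f \<phi> where g: "g = semiaffine a b c d e f \<phi>" "a * d - b * c = 1" "\<phi> \<in> H"
      by blast
    define A :: "'a ^ 2 ^ 2" where "A = vector [vector [a, b], vector [c, d]]"
    have "g = (\<lambda>x. A *v (\<chi> i. \<phi> (x $ i)) + vector [e, f])"
      unfolding g by (rule ext) (simp add: vec_eq_iff_2 matrix_vector_mult_def sum_2 A_def)
    moreover have "det A = 1"
      using g by (simp add: A_def det_2)
    ultimately show "g \<in> ?L"
      using g(3) unfolding ASL_def by blast
  qed
qed

lemma semiaffine_mem_ASL: "a * d - b * c = 1 \<Longrightarrow> \<phi> \<in> H \<Longrightarrow> semiaffine a b c d e f \<phi> \<in> ASL H"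
  unfolding ASL_2_eq by blast

section \<open>Group laws and two-transitivity of the semiaffine maps\<close>

locale field_automorphism_group = transformation_group H for H :: "('a :: {field,finite} \<Rightarrow> 'a) set" +
  assumes automorphism: "\<phi> \<in> H \<Longrightarrow> field_automorphism \<phi>"
begin

lemma ASL_comp:
  assumes "g \<in> ASL H" "h \<in> ASL H"
  shows "(g \<circ> h :: 'a ^ 2 \<Rightarrow> _) \<in> ASL H"
proof -
  obtain a b c d e f \<phi> where g: "g = semiaffine a b c d e f \<phi>" "a * d - b * c = 1" "\<phi> \<in> H"
    using assms(1) unfolding ASL_2_eq by blast
  obtain a' b' c' d' e' f' \<psi> where h: "h = semiaffine a' b' c' d' e' f' \<psi>" "a' * d' - b' * c' = 1" "\<psi> \<in> H"
    using assms(2) unfolding ASL_2_eq by blast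
  note \<phi> = field_automorphismD[OF automorphism[OF g(3)]]
  \<comment> \<open>The linear part is A \<phi>(A') and the translation A \<phi>(v') + v, with
    \<phi> applied entrywise; the determinant of the former is det A times \<phi>(det A').\<close>
  have "g \<circ> h = semiaffine (a * \<phi> a' + b * \<phi> c') (a * \<phi> b' + b * \<phi> d') (c * \<phi> a' + d * \<phi> c')
      (c * \<phi> b' + d * \<phi> d') (a * \<phi> e' + b * \<phi> f' + e) (c * \<phi> e' + d * \<phi> f' + f) (\<phi> \<circ> \<psi>)"
    by (rule ext) (simp add: vec_eq_iff_2 g h \<phi>(4,5) algebra_simps)
  moreover have "(a * \<phi> a' + b * \<phi> c') * (c * \<phi> b' + d * \<phi> d') -
      (a * \<phi> b' + b * \<phi> d') * (c * \<phi> a' + d * \<phi> c') = (a * d - b * c) * \<phi> (a' * d' - b' * c')"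
    unfolding \<phi>(5,7) by (simp add: algebra_simps)
  ultimately show ?thesis
    using semiaffine_mem_ASL[OF _ comp_mem[OF g(3) h(3)]] g(2) h(2) \<phi>(3) by simp
qed

lemma ASL_left_inverse:
  assumes "g \<in> ASL H"
  shows "\<exists>h\<in>ASL H. h \<circ> g = (id :: 'a ^ 2 \<Rightarrow> _)"
proof -
  obtain a b c d e f \<phi> where g: "g = semiaffine a b c d e f \<phi>" "a * d - b * c = 1" "\<phi> \<in> H"
    using assms unfolding ASL_2_eq by blast
  define \<psi> where "\<psi> = inv \<phi>"
  have "\<psi> \<in> H"
    using g(3) inv_mem by (simp add: \<psi>_def)
  note \<psi> = field_automorphismD[OF automorphism[OF this]]
  have \<psi>\<phi>: "\<psi> (\<phi> x) = x" for x
    using bij_mem[OF g(3)] by (simp add: \<psi>_def bij_is_inj)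
  \<comment> \<open>This is y -> \<psi>(A^(-1) (y - v)); as det A = 1, the inverse of A is its
    adjugate, with rows (d, -b) and (-c, a).\<close>
  define h where "h = semiaffine (\<psi> d) (- \<psi> b) (- \<psi> c) (\<psi> a) (\<psi> (b * f - d * e)) (\<psi> (c * e - a * f)) \<psi>"
  have "h (g x) = x" for x
  proof -
    have "h (g x) $ 1 = \<psi> (d * (a * \<phi> (x $ 1) + b * \<phi> (x $ 2) + e)
        - b * (c * \<phi> (x $ 1) + d * \<phi> (x $ 2) + f) + (b * f - d * e))"
      unfolding h_def g(1) semiaffine_nth \<psi>(4,5,7) by simp
    also have "\<dots> = \<psi> ((a * d - b * c) * \<phi> (x $ 1))"
      by (rule arg_cong[of _ _ \<psi>]) (simp add: algebra_simps)
    finally have 1: "h (g x) $ 1 = x $ 1"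
      by (simp add: g(2) \<psi>\<phi>)
    have "h (g x) $ 2 = \<psi> (a * (c * \<phi> (x $ 1) + d * \<phi> (x $ 2) + f)
        - c * (a * \<phi> (x $ 1) + b * \<phi> (x $ 2) + e) + (c * e - a * f))"
      unfolding h_def g(1) semiaffine_nth \<psi>(4,5,7) by simp
    also have "\<dots> = \<psi> ((a * d - b * c) * \<phi> (x $ 2))"
      by (rule arg_cong[of _ _ \<psi>]) (simp add: algebra_simps)
    finally have "h (g x) $ 2 = x $ 2"
      by (simp add: g(2) \<psi>\<phi>)
    with 1 show ?thesis
      by (simp add: vec_eq_iff_2)
  qed
  moreover have "\<psi> d * \<psi> a - (- \<psi> b) * (- \<psi> c) = \<psi> (a * d - b * c)"
    unfolding \<psi>(5,7) by simp
  then have "h \<in> ASL H"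
    unfolding h_def using \<open>\<psi> \<in> H\<close> g(2) \<psi>(3) by (intro semiaffine_mem_ASL) simp_all
  ultimately show ?thesis
    by (auto simp: fun_eq_iff)
qed

lemma two_transitive_group_ASL:
  "two_transitive_group (ASL H) (vector [0, 0] :: 'a ^ 2) (vector [1, 0])"
proof
  show "id \<in> (ASL H :: ('a ^ 2 \<Rightarrow> _) set)"
  proof -
    have "id = semiaffine 1 0 0 1 0 0 id"
      by (rule ext) (simp add: vec_eq_iff_2)
    then show ?thesis
      using semiaffine_mem_ASL[of 1 1 0 0 id H 0 0] id_mem by (metis diff_zero mult.right_neutral mult_zero_right)
  qed
  show "g \<circ> h \<in> ASL H" if "g \<in> ASL H" "h \<in> ASL H" for g h :: "'a ^ 2 \<Rightarrow> _"
    using that by (rule ASL_comp)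
  show bij: "bij g" if "g \<in> ASL H" for g :: "'a ^ 2 \<Rightarrow> _"
  proof -
    have "inj g"
      using ASL_left_inverse[OF that] by (metis inj_on_id inj_on_imageI2)
    then show ?thesis
      by (simp add: bij_def finite_UNIV_inj_surj)
  qed
  show "inv g \<in> ASL H" if g: "g \<in> ASL H" for g :: "'a ^ 2 \<Rightarrow> _"
  proof -
    obtain h where h: "h \<in> ASL H" "h \<circ> g = id"
      using ASL_left_inverse[OF g] by blast
    then have "inv g = h"
      using bij[OF g] by (metis comp_id fun.map_id bij_is_surj comp_assoc id_comp surj_iff)
    with h show ?thesis
      by simp
  qed
  show "(vector [0, 0] :: 'a ^ 2) \<noteq> vector [1, 0]"
    by (simp add: vec_eq_iff_2)
  show "\<exists>g\<in>ASL H. g (vector [0, 0]) = x \<and> g (vector [1, 0]) = y" if "x \<noteq> y" for x y :: "'a ^ 2"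
  proof -
    \<comment> \<open>The translation must be \<open>x\<close> and the first column of the matrix
      \<open>y - x\<close>. This column is nonzero, so it can be completed to a matrix of
      determinant 1.\<close>
    let ?a = "y $ 1 - x $ 1" and ?c = "y $ 2 - x $ 2"
    obtain b d where "?a * d - b * ?c = 1"
    proof (cases "?a = 0")
      case False
      then show ?thesis
        by (intro that[of "1 / ?a" 0]) simp
    next
      case True
      with \<open>x \<noteq> y\<close> have "?c \<noteq> 0"
        by (simp add: vec_eq_iff_2)
      then show ?thesis
        by (intro that[of 0 "- 1 / ?c"]) simp
    qed
    then have "semiaffine ?a b ?c d (x $ 1) (x $ 2) id \<in> ASL H"
      using id_mem by (rule semiaffine_mem_ASL)
    then show ?thesis
      by (rule bexI[rotated]) (simp add: vec_eq_iff_2)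
  qed
qed

sublocale ASL: two_transitive_group "ASL H" "vector [0, 0] :: 'a ^ 2" "vector [1, 0]"
  by (rule two_transitive_group_ASL)

section \<open>Orbits of the stabiliser of the base pair, relations and valencies\<close>

abbreviation orb :: "'a \<Rightarrow> 'a set" where
  "orb a \<equiv> (\<lambda>\<phi>. \<phi> a) ` H"

lemma mem_orb: "a \<in> orb a"
  using imageI[OF id_mem, of "\<lambda>\<phi>. \<phi> a"] by simp

lemma zero_mem_orb_iff: "0 \<in> orb a \<longleftrightarrow> a = 0"
  using id_mem automorphism field_automorphism_eq_0_iff by (force simp: image_iff)

lemma orb_0: "orb 0 = {0}" and orb_1: "orb 1 = {1}"
  using id_mem automorphism field_automorphismD(2,3) by (auto simp: image_iff)

text \<open>Fixing the origin removes the translation, fixing (1, 0) makes it the first column, and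
  determinant 1 then forces \<open>d = 1\<close>. Only the shear parameter \<open>b\<close> and the
  automorphism remain free.\<close>

lemma mem_triple_orbit_base_points_iff:
  fixes z w :: "'a ^ 2"
  shows "(vector [0, 0], vector [1, 0], z) \<in> triple_orbit (ASL H) (vector [0, 0], vector [1, 0], w) \<longleftrightarrow>
    (\<exists>b. \<exists>\<phi>\<in>H. z = vector [\<phi> (w $ 1) + b * \<phi> (w $ 2), \<phi> (w $ 2)])" (is "?L \<longleftrightarrow> ?R")
proof
  assume ?L
  then obtain g :: "'a ^ 2 \<Rightarrow> 'a ^ 2" where g: "g \<in> ASL H" "vector [0, 0] = g (vector [0, 0])"
    "vector [1, 0] = g (vector [1, 0])" "z = g w"
    unfolding triple_orbit_iff by blast
  then obtain a b c d e f \<phi> where s: "g = semiaffine a b c d e f \<phi>" "a * d - b * c = 1" "\<phi> \<in> H"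
    unfolding ASL_2_eq by blast
  note \<phi> = field_automorphismD[OF automorphism[OF s(3)]]
  have ef: "e = 0" "f = 0"
    using g(2) \<phi>(2) by (simp_all add: s vec_eq_iff_2)
  then have "a = 1" "c = 0"
    using g(3) \<phi>(2,3) by (simp_all add: s vec_eq_iff_2)
  then have "z = vector [\<phi> (w $ 1) + b * \<phi> (w $ 2), \<phi> (w $ 2)]"
    using s(2) ef by (simp add: g(4) s(1) vec_eq_iff_2)
  with s(3) show ?R
    by blast
next
  assume ?R
  then obtain b \<phi> where z: "\<phi> \<in> H" "z = vector [\<phi> (w $ 1) + b * \<phi> (w $ 2), \<phi> (w $ 2)]"
    by blast
  note \<phi> = field_automorphismD[OF automorphism[OF z(1)]]
  have "semiaffine 1 b 0 1 0 0 \<phi> \<in> ASL H"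
    using z(1) by (intro semiaffine_mem_ASL) simp_all
  then show ?L
    unfolding triple_orbit_iff by (rule bexI[rotated]) (simp add: vec_eq_iff_2 z(2) \<phi>(2,3))
qed

lemma mem_rel_first_iff:
  "(vector [0, 0], vector [1, 0], z) \<in> rel_first (ASL H) a \<longleftrightarrow> z $ 1 \<in> orb a \<and> z $ 2 = 0"
proof -
  have "\<phi> 0 = 0" if "\<phi> \<in> H" for \<phi>
    using that automorphism field_automorphismD(2) by blast
  then show ?thesis
    unfolding rel_first_def mem_triple_orbit_base_points_iff
      vec_eq_iff_2 vector_2 image_iff by (metis add.right_neutral mult_zero_right)
qed

text \<open>Since \<open>\<phi> a\<close> is nonzero, a suitable shear produces any prescribed first
  coordinate, so only the second coordinate is constrained.\<close>

lemma mem_rel_second_iff: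
  assumes "a \<noteq> 0"
  shows "(vector [0, 0], vector [1, 0], z) \<in> rel_second (ASL H) a \<longleftrightarrow> z $ 2 \<in> orb a"
proof -
  have "\<phi> 0 = 0" "\<phi> a \<noteq> 0" if "\<phi> \<in> H" for \<phi>
    using that automorphism field_automorphismD(2) field_automorphism_eq_0_iff assms by blast+
  then have "\<exists>b. z $ 1 = \<phi> 0 + b * \<phi> a" if "\<phi> \<in> H" for \<phi>
    using that by (auto intro!: exI[of _ "z $ 1 / \<phi> a"])
  then show ?thesis
    unfolding rel_second_def mem_triple_orbit_base_points_iff vec_eq_iff_2 vector_2 image_iff by blast
qed

lemma has_third_valency_rel_first:
  "has_third_valency UNIV (rel_first (ASL H) a) (card (orb a))"
proof -
  have "{z. (vector [0, 0], vector [1, 0], z) \<in> rel_first (ASL H) a} = (\<lambda>b. vector [b, 0]) ` orb a"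
    unfolding mem_rel_first_iff by (force simp: image_iff vec_eq_iff_2)
  moreover have "inj_on (\<lambda>b. vector [b, 0] :: 'a ^ 2) (orb a)"
    by (auto simp: inj_on_def vec_eq_iff_2)
  ultimately have "card {z. (vector [0, 0], vector [1, 0], z) \<in> rel_first (ASL H) a} = card (orb a)"
    by (simp add: card_image)
  then show ?thesis
    using ASL.has_third_valency_triple_orbit[of "(vector [0, 0], vector [1, 0], vector [a, 0])"]
    by (simp only: rel_first_def)
qed

text \<open>The possible third points form the product of the whole field with the
  \<open>H\<close>-orbit of \<open>a\<close>.\<close>

lemma has_third_valency_rel_second:
  assumes "a \<noteq> 0"
  shows "has_third_valency UNIV (rel_second (ASL H) a) (CARD('a) * card (orb a))"
proof -
  have "{z. (vector [0, 0], vector [1, 0], z) \<in> rel_second (ASL H) a} =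
      (\<lambda>(b, c). vector [b, c]) ` (UNIV \<times> orb a)"
    unfolding mem_rel_second_iff[OF assms] by (force simp: image_iff vec_eq_iff_2)
  moreover have "inj_on (\<lambda>(b, c). vector [b, c] :: 'a ^ 2) (UNIV \<times> orb a)"
    by (auto simp: inj_on_def vec_eq_iff_2)
  ultimately have "card {z. (vector [0, 0], vector [1, 0], z) \<in> rel_second (ASL H) a} =
      CARD('a) * card (orb a)"
    by (simp add: card_image card_cartesian_product)
  then show ?thesis
    using ASL.has_third_valency_triple_orbit[of "(vector [0, 0], vector [1, 0], vector [0, a])"]
    by (simp only: rel_second_def)
qed

lemma rel_first_eq_iff: "rel_first (ASL H) a = rel_first (ASL H) b \<longleftrightarrow> orb a = orb b"
proof
  assume *: "rel_first (ASL H) a = rel_first (ASL H) b"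
  have "c \<in> orb a \<longleftrightarrow> c \<in> orb b" for c
    using mem_rel_first_iff[of "vector [c, 0]" a] mem_rel_first_iff[of "vector [c, 0]" b] * by simp
  then show "orb a = orb b"
    by blast
next
  assume "orb a = orb b"
  then have "a \<in> orb b"
    using mem_orb by metis
  then have "(vector [0, 0], vector [1, 0], vector [a, 0]) \<in> rel_first (ASL H) b"
    by (simp add: mem_rel_first_iff)
  then show "rel_first (ASL H) a = rel_first (ASL H) b"
    using ASL.triple_orbit_eq by (simp add: rel_first_def)
qed

lemma rel_second_eq_iff:
  assumes "a \<noteq> 0" "b \<noteq> 0"
  shows "rel_second (ASL H) a = rel_second (ASL H) b \<longleftrightarrow> orb a = orb b"
proof
  assume *: "rel_second (ASL H) a = rel_second (ASL H) b"
  have "c \<in> orb a \<longleftrightarrow> c \<in> orb b" for c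
    using mem_rel_second_iff[OF assms(1), of "vector [0, c]"] mem_rel_second_iff[OF assms(2), of "vector [0, c]"] *
    by simp
  then show "orb a = orb b"
    by blast
next
  assume "orb a = orb b"
  then have "a \<in> orb b"
    using mem_orb by metis
  then have "(vector [0, 0], vector [1, 0], vector [0, a]) \<in> rel_second (ASL H) b"
    by (simp add: mem_rel_second_iff[OF assms(2)])
  then show "rel_second (ASL H) a = rel_second (ASL H) b"
    using ASL.triple_orbit_eq by (simp add: rel_second_def)
qed

text \<open>The third point either lies on the line through the base points, or has nonzero second
  coordinate; in the latter case a shear moves it to (0, a).\<close>

lemma nontrivial_relations_ASL:
  "nontrivial_relations UNIV (AST_of_action (ASL H) UNIV) =
    rel_first (ASL H) ` (- {0, 1}) \<union> rel_second (ASL H) ` (- {0})" (is "?N = ?F \<union> ?S")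
proof
  show "?N \<subseteq> ?F \<union> ?S"
  proof
    fix R assume "R \<in> ?N"
    then obtain z where z: "z \<noteq> vector [0, 0]" "z \<noteq> vector [1, 0]"
      and R: "R = triple_orbit (ASL H) (vector [0, 0], vector [1, 0], z)"
      unfolding ASL.nontrivial_relations_AST_of_action by blast
    show "R \<in> ?F \<union> ?S"
    proof (cases "z $ 2 = 0")
      case True
      then have "z = vector [z $ 1, 0]"
        by (simp add: vec_eq_iff_2)
      then have "R = rel_first (ASL H) (z $ 1)"
        using R by (simp add: rel_first_def)
      moreover have "z $ 1 \<notin> {0, 1}"
        using z True by (auto simp: vec_eq_iff_2)
      ultimately show ?thesis
        by blast
    next
      case False
      then have "(vector [0, 0], vector [1, 0], z) \<in> rel_second (ASL H) (z $ 2)"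
        using mem_rel_second_iff[OF False] mem_orb by blast
      then have "R = rel_second (ASL H) (z $ 2)"
        using R ASL.triple_orbit_eq by (simp add: rel_second_def)
      with False show ?thesis
        by blast
    qed
  qed
  show "?F \<union> ?S \<subseteq> ?N"
    unfolding ASL.nontrivial_relations_AST_of_action rel_first_def rel_second_def
    by (auto simp: vec_eq_iff_2 intro!: imageI)
qed

text \<open>The third point (a, 0) occurs in the first relation; in the second it would put 0 into
  the orbit of the nonzero \<open>b\<close>.\<close>

lemma rel_first_ne_rel_second: "b \<noteq> 0 \<Longrightarrow> rel_first (ASL H) a \<noteq> rel_second (ASL H) b"
  using mem_rel_first_iff[of "vector [a, 0]" a] mem_rel_second_iff[of b "vector [a, 0]"]
    mem_orb[of a] zero_mem_orb_iff[of b] by auto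

text \<open>Automorphisms fix 0, so excluding it removes exactly one orbit.\<close>

lemma card_orb_nonzero: "Suc (card (orb ` (- {0}))) = card (range orb)"
proof -
  have "range orb = insert (orb 0) (orb ` (- {0}))"
    by auto
  moreover have "orb 0 \<notin> orb ` (- {0})"
    using mem_orb by (force simp: orb_0)
  ultimately show ?thesis
    by simp
qed

text \<open>The element 1 is a second singleton orbit, which is removed as well.\<close>

lemma card_orb_nontrivial: "Suc (Suc (card (orb ` (- {0, 1})))) = card (range orb)"
proof -
  have "- {0 :: 'a} = insert 1 (- {0, 1})"
    by auto
  then have "orb ` (- {0}) = insert (orb 1) (orb ` (- {0, 1}))"
    by simp
  moreover have "orb 1 \<notin> orb ` (- {0, 1})"
    using mem_orb by (force simp: orb_1)
  ultimately show ?thesis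
    by (simp flip: card_orb_nonzero)
qed

end

theorem theorem3p2:
  fixes p \<alpha> \<omega> n q :: nat
    and K :: "'a :: {field, finite} set"
    and H :: "('a \<Rightarrow> 'a) set"
    and G :: "('a ^ 2 \<Rightarrow> 'a ^ 2) set"
    and X :: "(('a ^ 2) \<times> ('a ^ 2) \<times> ('a ^ 2)) set set"
  assumes "prime p" and "n = p ^ \<alpha>" and "CARD('a) = n"
    and "\<omega> dvd \<alpha>" and "q = p ^ \<omega>"
    and "is_subfield K" and "card K = q"
    and "H = Gal K" and "G = ASL H"
    and "X = AST_of_action G UNIV"
  shows "AST UNIV X \<and>
    real (card (nontrivial_relations UNIV X)) =
      -3 + 2 * (real \<omega> / real \<alpha> * (\<Sum>\<beta>=1..\<alpha> div \<omega>. real q ^ gcd (\<alpha> div \<omega>) \<beta>)) \<and>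
    {rel_first G a | a. a \<noteq> 0 \<and> a \<noteq> 1} \<subseteq> nontrivial_relations UNIV X \<and>
    real (card {rel_first G a | a. a \<noteq> 0 \<and> a \<noteq> 1}) =
      -2 + real \<omega> / real \<alpha> * (\<Sum>\<beta>=1..\<alpha> div \<omega>. real q ^ gcd (\<alpha> div \<omega>) \<beta>) \<and>
    (\<forall>a. a \<noteq> 0 \<and> a \<noteq> 1 \<longrightarrow> has_third_valency UNIV (rel_first G a) (deg_over K a)) \<and>
    nontrivial_relations UNIV X - {rel_first G a | a. a \<noteq> 0 \<and> a \<noteq> 1} =
      {rel_second G a | a. a \<noteq> 0} \<and>
    real (card {rel_second G a | a. a \<noteq> 0}) =
      -1 + real \<omega> / real \<alpha> * (\<Sum>\<beta>=1..\<alpha> div \<omega>. real q ^ gcd (\<alpha> div \<omega>) \<beta>) \<and>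
    (\<forall>a. a \<noteq> 0 \<longrightarrow> has_third_valency UNIV (rel_second G a) (n * deg_over K a))"
proof -
  define m where "m = \<alpha> div \<omega>"
  have \<alpha>: "\<alpha> = \<omega> * m"
    using \<open>\<omega> dvd \<alpha>\<close> by (simp add: m_def)
  interpret E: finite_field_extension K p q \<omega> m
    by standard (use assms in \<open>simp_all add: \<alpha> power_mult\<close>)
  interpret H: transformation_group H
    unfolding \<open>H = Gal K\<close> by (rule transformation_group_Gal)
  interpret H: field_automorphism_group H
    by standard (simp add: \<open>H = Gal K\<close> Gal_def)
  \<comment> \<open>The number of \<open>H\<close>-orbits on the field: the two families have N - 2
    and N - 1 members, 2N - 3 in all.\<close>
  define N where "N = card (range (\<lambda>a. (\<lambda>\<phi>. \<phi> a) ` H))"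
  have "\<omega> > 0"
    using E.q_ge_2 \<open>q = p ^ \<omega>\<close> by (cases "\<omega> = 0") auto
  have "real (m * N) = real (\<Sum>\<beta>=1..m. q ^ gcd m \<beta>)"
    using E.card_Gal_orbits by (simp add: N_def \<open>H = Gal K\<close>)
  \<comment> \<open>As \<omega>/\<alpha> = 1/m, the expression is the Burnside average; positivity
    of \<omega> and \<open>m\<close> justifies the division.\<close>
  then have N: "real \<omega> / real \<alpha> * (\<Sum>\<beta>=1..\<alpha> div \<omega>. real q ^ gcd (\<alpha> div \<omega>) \<beta>) = real N"
    unfolding m_def[symmetric] using \<open>\<omega> > 0\<close> E.m_pos by (simp add: \<alpha> field_simps)
  define F where "F = rel_first G ` (- {0, 1})"
  define S where "S = rel_second G ` (- {0})"
  have F_eq: "{rel_first G a | a. a \<noteq> 0 \<and> a \<noteq> 1} = F" and S_eq: "{rel_second G a | a. a \<noteq> 0} = S"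
    by (auto simp: F_def S_def)
  have nontrivial: "nontrivial_relations UNIV X = F \<union> S"
    unfolding F_def S_def \<open>X = _\<close> \<open>G = _\<close> by (rule H.nontrivial_relations_ASL)
  have disjoint: "F \<inter> S = {}"
    using H.rel_first_ne_rel_second unfolding F_def S_def \<open>G = _\<close> by blast
  have "card F = card ((\<lambda>a. (\<lambda>\<phi>. \<phi> a) ` H) ` (- {0, 1}))"
    unfolding F_def \<open>G = _\<close> by (rule card_image_cong_eq) (rule H.rel_first_eq_iff)
  then have card_F: "Suc (Suc (card F)) = N"
    using H.card_orb_nontrivial by (simp add: N_def)
  have "card S = card ((\<lambda>a. (\<lambda>\<phi>. \<phi> a) ` H) ` (- {0}))"
    unfolding S_def \<open>G = _\<close> by (rule card_image_cong_eq) (simp add: H.rel_second_eq_iff)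
  then have card_S: "Suc (card S) = N"
    using H.card_orb_nonzero by (simp add: N_def)
  have card_nontrivial: "card (F \<union> S) = card F + card S"
    using disjoint by (intro card_Un_disjoint) (simp_all add: F_def S_def)
  have deg: "deg_over K a = card ((\<lambda>\<phi>. \<phi> a) ` H)" for a
    by (simp add: \<open>H = Gal K\<close> E.Gal_orbit_eq E.deg_over_eq)
  \<comment> \<open>A field has at least two elements, so the plane has at least four
    points.\<close>
  have "card {0, 1 :: 'a} = 2"
    by simp
  then have "2 \<le> CARD('a)"
    by (metis card_mono finite subset_UNIV)
  then have "2 * 2 \<le> CARD('a) * CARD('a)"
    by (intro mult_le_mono)
  then have "3 \<le> CARD('a ^ 2)"
    by (simp add: power2_eq_square)
  then have "AST UNIV X"
    unfolding \<open>X = _\<close> \<open>G = _\<close> by (rule H.ASL.AST_AST_of_action)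
  moreover have "has_third_valency UNIV (rel_first G a) (deg_over K a)" for a
    unfolding deg \<open>G = _\<close> by (rule H.has_third_valency_rel_first)
  moreover have "has_third_valency UNIV (rel_second G a) (n * deg_over K a)" if "a \<noteq> 0" for a
    unfolding deg \<open>G = _\<close> \<open>CARD('a) = n\<close>[symmetric] using that by (rule H.has_third_valency_rel_second)
  moreover have "real (card F) = - 2 + real N" "real (card S) = - 1 + real N"
    using card_F card_S by simp_all
  moreover have "real (card (F \<union> S)) = - 3 + 2 * real N"
    using card_F card_S card_nontrivial by simp
  moreover have "(F \<union> S) - F = S"
    using disjoint by blast
  ultimately show ?thesis
    unfolding F_eq S_eq nontrivial N by simp
qed

end
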